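(* For every value of the spatial locality $\Delta$, no deterministic online algorithm for homing or nomadic online TSP (and hence for homing or nomadic online dial-a-ride) in the spatial locality model, with no assumption on the order of arrivals (requests need not arrive sequentially), can be $c$-competitive for any $c<2$.
   Context: Model. A metric space $(\mathcal{M},dist)$ (symmetric, triangle inequality) of diameter $D$ with a distinguished origin $o$. A single server starts at $o$ at time $0$ and moves at unit speed. Requests $r_i=(t_i,e_i,d_i)$ (release time, source, destination; $e_i=d_i$ for online TSP) arrive online and are revealed only at time $t_i$; several requests may be released at the same time and at arbitrary times. A request is served when the server visits $e_i$ at a time $\ge t_i$ and then $d_i$; the completion time is when this happens. Nomadic version: cost is the maximum completion time. Homing version: the server must additionally return to $o$, and the cost is the time of return after all requests are served. $OPT(\sigma)$ is the optimal offline cost for the request sequence $\sigma$ (known in advance, respecting release times). Spatial locality $\Delta$: every request released at time $t$ has source within distance $\Delta$ of the server's position at time $t$. An algorithm is $c$-competitive if its cost is at most $c\cdot OPT(\sigma)$ for every admissible $\sigma$.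
   Formalization: The spatial locality Δ is taken to be positive: for Δ = 0 every online TSP request appears at the server's own position, so a server that stays at the origin is 1-competitive and the claim fails. *)

theory Defs
  imports "HOL-Analysis.Analysis"
begin

text \<open>
  A continuously moving server needs a space in which any two points are joined by a shortest
  path; otherwise (e.g. in a discrete space) a unit-speed server could not move at all.
\<close>

definition geodesic_space :: "'a set \<Rightarrow> ('a \<Rightarrow> 'a \<Rightarrow> real) \<Rightarrow> bool" where
  "geodesic_space M d \<longleftrightarrow>
     (\<forall>x\<in>M. \<forall>y\<in>M. \<exists>g :: real \<Rightarrow> 'a.
        g 0 = x \<and> g (d x y) = y \<and> g ` {0..d x y} \<subseteq> M \<and>
        (\<forall>s\<in>{0..d x y}. \<forall>t\<in>{0..d x y}. d (g s) (g t) = \<bar>s - t\<bar>))"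

definition server_space :: "'a set \<Rightarrow> ('a \<Rightarrow> 'a \<Rightarrow> real) \<Rightarrow> 'a \<Rightarrow> real \<Rightarrow> bool" where
  "server_space M d orig D \<longleftrightarrow>
     Metric_space M d \<and> geodesic_space M d \<and> orig \<in> M \<and>
     (SUP (x, y)\<in>M \<times> M. ereal (d x y)) = ereal D"

datatype 'a request = Request (release: real) (source: 'a) (destination: 'a)

text \<open>
  Request sequences are finite and listed by release time. Simultaneous requests and arbitrary
  release times are allowed; in particular a request may be released while others are pending.
\<close>

definition darp_sequences :: "'a set \<Rightarrow> 'a request list set" where
  "darp_sequences M =
     {\<sigma>. sorted (map release \<sigma>) \<and>
          (\<forall>r\<in>set \<sigma>. 0 \<le> release r \<and> source r \<in> M \<and> destination r \<in> M)}"

definition tsp_sequences :: "'a set \<Rightarrow> 'a request list set" where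
  "tsp_sequences M = {\<sigma> \<in> darp_sequences M. \<forall>r\<in>set \<sigma>. source r = destination r}"

text \<open>Moving at unit speed includes the possibility of waiting. Only times \<open>t \<ge> 0\<close> matter.\<close>

definition server_path :: "'a set \<Rightarrow> ('a \<Rightarrow> 'a \<Rightarrow> real) \<Rightarrow> 'a \<Rightarrow> (real \<Rightarrow> 'a) \<Rightarrow> bool" where
  "server_path M d orig p \<longleftrightarrow>
     p 0 = orig \<and> p ` {0..} \<subseteq> M \<and> (\<forall>s\<ge>0. \<forall>t\<ge>0. d (p s) (p t) \<le> \<bar>s - t\<bar>)"

text \<open>The infimum over an empty set of times is \<open>\<infinity>\<close>: a request that is never served has infinite completion time,
  and a server that never returns has infinite homing cost.\<close>

definition completion_time :: "(real \<Rightarrow> 'a) \<Rightarrow> 'a request \<Rightarrow> ennreal" where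
  "completion_time p r =
     (INF t\<in>{t. \<exists>s. release r \<le> s \<and> s \<le> t \<and> p s = source r \<and> p t = destination r}. ennreal t)"

datatype variant = Nomadic | Homing

definition last_completion :: "(real \<Rightarrow> 'a) \<Rightarrow> 'a request list \<Rightarrow> ennreal" where
  "last_completion p \<sigma> = (SUP r\<in>set \<sigma>. completion_time p r)"

fun cost :: "variant \<Rightarrow> 'a \<Rightarrow> (real \<Rightarrow> 'a) \<Rightarrow> 'a request list \<Rightarrow> ennreal" where
  "cost Nomadic orig p \<sigma> = last_completion p \<sigma>"
| "cost Homing orig p \<sigma> =
     (INF t\<in>{t. 0 \<le> t \<and> last_completion p \<sigma> \<le> ennreal t \<and> p t = orig}. ennreal t)"

definition OPT ::
  "variant \<Rightarrow> 'a set \<Rightarrow> ('a \<Rightarrow> 'a \<Rightarrow> real) \<Rightarrow> 'a \<Rightarrow> 'a request list \<Rightarrow> ennreal" where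
  "OPT v M d orig \<sigma> = (INF p\<in>Collect (server_path M d orig). cost v orig p \<sigma>)"

text \<open>
  A deterministic online algorithm assigns to every request sequence in the class \<open>S\<close> a server
  path whose position at time \<open>t\<close> is determined by the requests released up to time \<open>t\<close>.
\<close>

definition online_algorithm ::
  "'a set \<Rightarrow> ('a \<Rightarrow> 'a \<Rightarrow> real) \<Rightarrow> 'a \<Rightarrow> 'a request list set \<Rightarrow>
   ('a request list \<Rightarrow> real \<Rightarrow> 'a) \<Rightarrow> bool" where
  "online_algorithm M d orig S A \<longleftrightarrow>
     (\<forall>\<sigma>\<in>S. server_path M d orig (A \<sigma>)) \<and>
     (\<forall>\<sigma>\<in>S. \<forall>\<tau>\<in>S. \<forall>t\<ge>0.
        filter (\<lambda>r. release r \<le> t) \<sigma> = filter (\<lambda>r. release r \<le> t) \<tau> \<longrightarrow> A \<sigma> t = A \<tau> t)"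

text \<open>Locality refers to the position of the online server, not to that of the optimum.\<close>

definition spatially_local ::
  "('a \<Rightarrow> 'a \<Rightarrow> real) \<Rightarrow> real \<Rightarrow> (real \<Rightarrow> 'a) \<Rightarrow> 'a request list \<Rightarrow> bool" where
  "spatially_local d \<Delta> p \<sigma> \<longleftrightarrow> (\<forall>r\<in>set \<sigma>. d (p (release r)) (source r) \<le> \<Delta>)"

definition competitive ::
  "variant \<Rightarrow> 'a set \<Rightarrow> ('a \<Rightarrow> 'a \<Rightarrow> real) \<Rightarrow> 'a \<Rightarrow> real \<Rightarrow> 'a request list set \<Rightarrow> real \<Rightarrow>
   ('a request list \<Rightarrow> real \<Rightarrow> 'a) \<Rightarrow> bool" where
  "competitive v M d orig \<Delta> S c A \<longleftrightarrow>
     (\<forall>\<sigma>\<in>S. spatially_local d \<Delta> (A \<sigma>) \<sigma> \<longrightarrow>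
        cost v orig (A \<sigma>) \<sigma> \<le> ennreal c * OPT v M d orig \<sigma>)"

end

theory Submission
  imports Defs
begin

text \<open>
  The space is a star with infinitely many rays of length \<open>D/2\<close>. Put \<open>e = min \<Delta> (D/2)\<close> and call
  the points at distance \<open>e\<close> from the centre on the first \<open>N\<close> rays leaves. All leaves are
  requested at time 0, and then, at each multiple of \<open>e\<close> up to \<open>T = 2 e N\<close>, every leaf that the online
  server has visited during the preceding \<open>e\<close> time units is requested again; the server is
  then still within \<open>e \<le> \<Delta>\<close> of it. At time \<open>T\<close> all leaves but at most one have an unserved request, and two
  leaves are \<open>2 e\<close> apart, so the online cost is at least \<open>T + 2 e (N - 2)\<close>. Offline, time is
  divided into slots of length \<open>2 e\<close>, in each of which one leaf is visited from the centre. Last visits of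
  the online server to different leaves fall into different slots, and the slot after
  such a visit is late enough to serve the leaf for good; leaves not visited by time \<open>T\<close> use the
  remaining slots. So \<open>N + 2\<close> slots suffice, and the ratio tends to 2.
\<close>

section \<open>Separated visits\<close>

text \<open>Equal floors of \<open>t / w\<close> put two times into one half-open interval of length
  \<open>w\<close>. With \<open>w = 2 * e\<close> this gives visits to different leaves different
  slots.\<close>

lemma inj_on_floor_separated:
  fixes t :: "'i \<Rightarrow> real"
  assumes "w > 0" and "\<And>i j. i \<in> I \<Longrightarrow> j \<in> I \<Longrightarrow> i \<noteq> j \<Longrightarrow> w \<le> \<bar>t i - t j\<bar>"
  shows "inj_on (\<lambda>i. \<lfloor>t i / w\<rfloor>) I"
proof (rule inj_onI, rule ccontr)
  fix i j assume "i \<in> I" "j \<in> I" "\<lfloor>t i / w\<rfloor> = \<lfloor>t j / w\<rfloor>" "i \<noteq> j"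
  then have "\<bar>t i / w - t j / w\<bar> < 1" by linarith
  then have "\<bar>(t i - t j) / w\<bar> < 1" by (simp add: diff_divide_distrib)
  then have "\<bar>t i - t j\<bar> < w" using \<open>w > 0\<close> by (simp add: abs_divide field_simps)
  then show False using assms(2)[of i j] \<open>i \<in> I\<close> \<open>j \<in> I\<close> \<open>i \<noteq> j\<close> by simp
qed

text \<open>The shifted floors inject into \<open>m\<close> slots. The window must be half-open: a
  closed one could hold \<open>m + 1\<close> such times.\<close>

lemma card_separated_le:
  fixes t :: "'i \<Rightarrow> real"
  assumes "w > 0" and "\<And>i j. i \<in> I \<Longrightarrow> j \<in> I \<Longrightarrow> i \<noteq> j \<Longrightarrow> w \<le> \<bar>t i - t j\<bar>"
    and "\<And>i. i \<in> I \<Longrightarrow> a \<le> t i \<and> t i < a + w * real m"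
  shows "card I \<le> m"
proof -
  have inj: "inj_on (\<lambda>i. \<lfloor>(t i - a) / w\<rfloor>) I"
    by (rule inj_on_floor_separated) (use assms in auto)
  have "(\<lambda>i. \<lfloor>(t i - a) / w\<rfloor>) ` I \<subseteq> {0..<int m}"
  proof safe
    fix i assume "i \<in> I"
    then have "0 \<le> (t i - a) / w" "(t i - a) / w < real m"
      using assms(1) assms(3)[of i] by (auto simp: field_simps)
    then show "\<lfloor>(t i - a) / w\<rfloor> \<in> {0..<int m}" by (simp add: floor_less_iff)
  qed
  from card_inj_on_le[OF inj this] show ?thesis by simp
qed

lemma inj_on_extend:
  assumes "inj_on f A" "f ` A \<subseteq> C" "A \<subseteq> B" "finite B" "finite C" "card B \<le> card C"
  obtains g where "inj_on g B" "g ` B \<subseteq> C" "\<And>x. x \<in> A \<Longrightarrow> g x = f x"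
proof -
  have "finite A" using assms finite_subset by blast
  then have "card (B - A) \<le> card (C - f ` A)"
    using assms by (simp add: card_Diff_subset card_image)
  then obtain h where h: "h ` (B - A) \<subseteq> C - f ` A" "inj_on h (B - A)"
    using card_le_inj[of "B - A" "C - f ` A"] assms by auto
  define g where "g x = (if x \<in> A then f x else h x)" for x
  have "inj_on g (A \<union> (B - A))"
  proof (subst inj_on_Un, intro conjI)
    have img: "g ` A = f ` A" "g ` (B - A) = h ` (B - A)" by (auto simp: g_def)
    show "inj_on g A" using assms(1) by (simp add: inj_on_def g_def)
    show "inj_on g (B - A)" using h(2) by (simp add: inj_on_def g_def)
    have "A - (B - A) = A" "B - A - A = B - A" by auto
    then show "g ` (A - (B - A)) \<inter> g ` (B - A - A) = {}" using img h(1) by auto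
  qed
  then have "inj_on g B" using assms(3) by (simp add: Un_absorb1)
  moreover have "g ` B \<subseteq> C" using assms h by (auto simp: g_def)
  ultimately show thesis using that[of g] by (simp add: g_def)
qed

section \<open>The star\<close>

text \<open>The clause on \<open>x = 0\<close> keeps a single representative of the centre;
  otherwise distance 0 would not imply equality.\<close>

definition star :: "real \<Rightarrow> (nat \<times> real) set" where
  "star l = {(i, x). 0 \<le> x \<and> x \<le> l \<and> (x = 0 \<longrightarrow> i = 0)}"

text \<open>The hedgehog metric. The absolute values keep it nonnegative off the star too, as
  \<open>Metric_space\<close> demands.\<close>

definition star_dist :: "nat \<times> real \<Rightarrow> nat \<times> real \<Rightarrow> real" where
  "star_dist p q = (if fst p = fst q then \<bar>snd p - snd q\<bar> else \<bar>snd p\<bar> + \<bar>snd q\<bar>)"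

text \<open>All rays share their initial point, represented by \<open>(0, 0)\<close>.\<close>

definition on_ray :: "nat \<Rightarrow> real \<Rightarrow> nat \<times> real" where
  "on_ray i x = (if x = 0 then (0, 0) else (i, x))"

lemma on_ray_0 [simp]: "on_ray i 0 = (0, 0)"
  by (simp add: on_ray_def)

lemma on_ray_in_star: "0 \<le> x \<Longrightarrow> x \<le> l \<Longrightarrow> on_ray i x \<in> star l"
  by (auto simp: on_ray_def star_def)

lemma star_dist_on_ray:
  "star_dist (on_ray i x) (on_ray j y) = (if i = j then \<bar>x - y\<bar> else \<bar>x\<bar> + \<bar>y\<bar>)"
  by (auto simp: on_ray_def star_dist_def)

lemma star_cases:
  assumes "p \<in> star l"
  obtains i x where "p = on_ray i x" "0 \<le> x" "x \<le> l"
proof (rule that)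
  show "p = on_ray (fst p) (snd p)" "0 \<le> snd p" "snd p \<le> l"
    using assms by (auto simp: star_def on_ray_def)
qed

lemma Metric_space_star: "Metric_space (star l) star_dist"
  by unfold_locales (auto simp: star_def star_dist_def split: if_splits)

lemma geodesic_space_star: "geodesic_space (star l) star_dist"
  unfolding geodesic_space_def
proof (intro ballI)
  fix p q assume "p \<in> star l" "q \<in> star l"
  then obtain i x j y where p: "p = on_ray i x" "0 \<le> x" "x \<le> l"
    and q: "q = on_ray j y" "0 \<le> y" "y \<le> l"
    by (metis star_cases)
  show "\<exists>g. g 0 = p \<and> g (star_dist p q) = q \<and> g ` {0..star_dist p q} \<subseteq> star l \<and>
    (\<forall>s\<in>{0..star_dist p q}. \<forall>t\<in>{0..star_dist p q}. star_dist (g s) (g t) = \<bar>s - t\<bar>)"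
  proof (cases "i = j")
    case True
    define g where "g s = on_ray i (if x \<le> y then x + s else x - s)" for s
    have "star_dist p q = \<bar>x - y\<bar>" using True p q by (simp add: star_dist_on_ray)
    then show ?thesis using p q True
      by (intro exI[of _ g]) (auto simp: g_def star_dist_on_ray intro!: on_ray_in_star)
  next
    case False
    \<comment> \<open>In to the centre, then out along the other ray; at \<open>s = x\<close> both
      branches give \<open>(0, 0)\<close>.\<close>
    define g where "g s = (if s \<le> x then on_ray i (x - s) else on_ray j (s - x))" for s
    have "star_dist p q = x + y" using False p q by (simp add: star_dist_on_ray)
    moreover have "g (x + y) = q" using q by (cases "y = 0") (auto simp: g_def)
    ultimately show ?thesis using p q False
      by (intro exI[of _ g]) (auto simp: g_def star_dist_on_ray intro!: on_ray_in_star)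
  qed
qed

lemma server_space_star:
  assumes "D > 0"
  shows "server_space (star (D/2)) star_dist (0, 0) D"
proof -
  have "(SUP (p, q)\<in>star (D/2) \<times> star (D/2). ereal (star_dist p q)) = ereal D"
  proof (rule antisym)
    show "(SUP (p, q)\<in>star (D/2) \<times> star (D/2). ereal (star_dist p q)) \<le> ereal D"
      by (rule SUP_least) (auto simp: star_def star_dist_def)
    have "((0, D/2), (1, D/2)) \<in> star (D/2) \<times> star (D/2)"
      using assms by (auto simp: star_def)
    from SUP_upper[OF this, of "\<lambda>(p, q). ereal (star_dist p q)"]
    show "ereal D \<le> (SUP (p, q)\<in>star (D/2) \<times> star (D/2). ereal (star_dist p q))"
      using assms by (simp add: star_dist_def)
  qed
  moreover have "(0, 0) \<in> star (D/2)" using assms by (simp add: star_def)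
  ultimately show ?thesis
    by (simp add: server_space_def Metric_space_star geodesic_space_star)
qed

section \<open>The offline tour\<close>

text \<open>The triangle wave of period \<open>w\<close>: the distance from \<open>t\<close> to the
  nearest integer multiple of \<open>w\<close>.\<close>

definition zigzag :: "real \<Rightarrow> real \<Rightarrow> real" where
  "zigzag w t = min (t - of_int \<lfloor>t / w\<rfloor> * w) ((of_int \<lfloor>t / w\<rfloor> + 1) * w - t)"

definition tour :: "real \<Rightarrow> (nat \<Rightarrow> nat) \<Rightarrow> real \<Rightarrow> nat \<times> real" where
  "tour w ray t = on_ray (ray (nat \<lfloor>t / w\<rfloor>)) (zigzag w t)"

lemma zigzag_bounds:
  assumes "w > 0"
  shows "0 \<le> zigzag w t" "zigzag w t \<le> w / 2"
proof -
  have "of_int \<lfloor>t / w\<rfloor> \<le> t / w" "t / w < of_int \<lfloor>t / w\<rfloor> + 1" by linarith+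
  then have "of_int \<lfloor>t / w\<rfloor> * w \<le> t" "t < (of_int \<lfloor>t / w\<rfloor> + 1) * w"
    using assms by (simp_all only: pos_le_divide_eq pos_divide_less_eq)
  then show "0 \<le> zigzag w t" by (simp add: zigzag_def)
  show "zigzag w t \<le> w / 2" by (auto simp: zigzag_def min_def field_simps)
qed

text \<open>Within a slot the ray is fixed and the wave has slopes 1 and -1. Between slots the tour
  passes the centre, and each height is at most the time separating its point from the slot boundary
  facing the other point.\<close>

lemma tour_lipschitz:
  assumes "w > 0"
  shows "star_dist (tour w ray s) (tour w ray t) \<le> \<bar>s - t\<bar>"
proof (induction s t rule: linorder_wlog)
  case (le s t)
  show ?case
  proof (cases "\<lfloor>s / w\<rfloor> = \<lfloor>t / w\<rfloor>")
    case True
    then show ?thesis by (auto simp: tour_def star_dist_on_ray zigzag_def min_def)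
  next
    case False
    have "\<lfloor>s / w\<rfloor> \<le> \<lfloor>t / w\<rfloor>" using le assms by (intro floor_mono) (simp add: divide_right_mono)
    with False have "of_int \<lfloor>s / w\<rfloor> + 1 \<le> (of_int \<lfloor>t / w\<rfloor> :: real)" by linarith
    then have "(of_int \<lfloor>s / w\<rfloor> + 1) * w \<le> of_int \<lfloor>t / w\<rfloor> * w"
      using assms by (intro mult_right_mono) auto
    moreover have "zigzag w s \<le> (of_int \<lfloor>s / w\<rfloor> + 1) * w - s" "zigzag w t \<le> t - of_int \<lfloor>t / w\<rfloor> * w"
      by (auto simp: zigzag_def)
    ultimately have "zigzag w s + zigzag w t \<le> \<bar>s - t\<bar>" by linarith
    then show ?thesis using zigzag_bounds(1)[OF assms, of s] zigzag_bounds(1)[OF assms, of t]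
      by (auto simp: tour_def star_dist_on_ray)
  qed
next
  case (sym s t)
  then show ?case
    using Metric_space.commute[OF Metric_space_star] by (metis abs_minus_commute)
qed

lemma tour_at_multiple:
  assumes "w > 0"
  shows "tour w ray (w * real k) = (0, 0)"
  using assms by (simp add: tour_def zigzag_def)

lemma tour_at_half:
  assumes "w > 0"
  shows "tour w ray (w * real k + w / 2) = on_ray (ray k) (w / 2)"
proof -
  have "(w * real k + w / 2) / w = real k + 1 / 2" using assms by (simp add: field_simps)
  moreover have "\<lfloor>real k + 1 / 2\<rfloor> = int k" by linarith
  ultimately have "\<lfloor>(w * real k + w / 2) / w\<rfloor> = int k" by simp
  then show ?thesis using assms by (simp add: tour_def zigzag_def algebra_simps)
qed

lemma server_path_tour:
  assumes "w > 0" "w / 2 \<le> l"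
  shows "server_path (star l) star_dist (0, 0) (tour w ray)"
proof -
  have "tour w ray t \<in> star l" for t
    using zigzag_bounds[OF assms(1), of t] assms(2) by (simp add: tour_def on_ray_in_star)
  then show ?thesis
    using tour_lipschitz[OF assms(1), of ray] tour_at_multiple[OF assms(1), of ray 0]
    by (auto simp: server_path_def)
qed

section \<open>The adversary\<close>

lemma completion_time_le:
  assumes "release r \<le> t" "p t = source r" "p t = destination r"
  shows "completion_time p r \<le> ennreal t"
  unfolding completion_time_def by (rule INF_lower) (use assms in auto)

text \<open>With \<open>cost_le\<close> this handles both variants at once: the online cost is
  bounded through the last completion, and the offline tour ends at the origin.\<close>

lemma last_completion_le_cost: "last_completion p \<sigma> \<le> cost v orig p \<sigma>"
  by (cases v) (auto intro: INF_greatest)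

lemma cost_le:
  assumes "last_completion p \<sigma> \<le> ennreal t" "0 \<le> t" "p t = orig"
  shows "cost v orig p \<sigma> \<le> ennreal t"
  using assms by (cases v) (auto intro: INF_lower)

lemma server_path_in: "server_path M d orig p \<Longrightarrow> 0 \<le> t \<Longrightarrow> p t \<in> M"
  by (auto simp: server_path_def)

text \<open>Unit speed implies continuity. Two inputs may differ in requests released exactly at
  \<open>T\<close>, so the online property alone yields agreement only before
  \<open>T\<close>.\<close>

lemma server_paths_agree_at_limit:
  assumes "Metric_space M d" "server_path M d orig p" "server_path M d orig q" "0 < T"
    and eq: "\<And>t. 0 \<le> t \<Longrightarrow> t < T \<Longrightarrow> p t = q t"
  shows "p T = q T"
proof -
  interpret Metric_space M d by fact
  have in_M: "p t \<in> M" "q t \<in> M" if "0 \<le> t" for t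
    using assms(2,3) that by (auto intro: server_path_in)
  have "d (p T) (q T) \<le> 0 + \<delta>" if "\<delta> > 0" for \<delta>
  proof -
    define t where "t = max 0 (T - \<delta> / 2)"
    have t: "0 \<le> t" "t < T" "T - t \<le> \<delta> / 2"
      using \<open>0 < T\<close> that unfolding t_def by linarith+
    have "d (p T) (q T) \<le> d (p T) (p t) + d (q t) (q T)"
      using triangle[of "p T" "p t" "q T"] eq[OF t(1,2)] in_M t(1) \<open>0 < T\<close> by simp
    moreover have "d (p T) (p t) \<le> \<bar>T - t\<bar>" "d (q t) (q T) \<le> \<bar>t - T\<bar>"
      using assms(2,3) t(1) less_imp_le[OF \<open>0 < T\<close>] unfolding server_path_def by blast+
    ultimately show ?thesis using t by linarith
  qed
  then have "d (p T) (q T) \<le> 0" by (rule field_le_epsilon)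
  then show ?thesis using in_M \<open>0 < T\<close> nonneg[of "p T" "q T"] by auto
qed

text \<open>Both ends are included, so a visit at a multiple of \<open>e\<close> counts for each
  adjacent window and none is missed.\<close>

definition visited_during :: "(real \<Rightarrow> 'a) \<Rightarrow> real \<Rightarrow> 'a \<Rightarrow> nat \<Rightarrow> bool" where
  "visited_during p e x k \<longleftrightarrow> (\<exists>s. e * real k \<le> s \<and> s \<le> e * real (Suc k) \<and> p s = x)"

text \<open>Each batch is read off from the run of \<open>A\<close> on the earlier batches only,
  which makes the recursion possible; \<open>online_adversary_agree\<close> identifies that run with
  later ones on the window concerned.\<close>

primrec adversary ::
  "('a request list \<Rightarrow> real \<Rightarrow> 'a) \<Rightarrow> (nat \<Rightarrow> 'a) \<Rightarrow> nat \<Rightarrow> real \<Rightarrow> nat \<Rightarrow> 'a request list" where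
  "adversary A leaf N e 0 = map (\<lambda>i. Request 0 (leaf i) (leaf i)) [0..<N]"
| "adversary A leaf N e (Suc k) = adversary A leaf N e k @
     map (\<lambda>i. Request (e * real (Suc k)) (leaf i) (leaf i))
       (filter (\<lambda>i. visited_during (A (adversary A leaf N e k)) e (leaf i) k) [0..<N])"

text \<open>The bound on release times is carried through the induction so that appending the next
  batch keeps the list sorted.\<close>

lemma adversary_in_tsp_sequences:
  assumes "e > 0" "\<And>i. i < N \<Longrightarrow> leaf i \<in> M"
  shows "adversary A leaf N e k \<in> tsp_sequences M \<and>
    (\<forall>r\<in>set (adversary A leaf N e k). release r \<le> e * real k)"
proof (induction k)
  case 0
  then show ?case
    using assms by (auto simp: tsp_sequences_def darp_sequences_def comp_def map_replicate_const)
next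
  case (Suc k)
  have le: "e * real k \<le> e * real (Suc k)" using assms by simp
  have "release r \<le> e * real (Suc k)" if "r \<in> set (adversary A leaf N e k)" for r
    using Suc that le by force
  then show ?case
    using Suc assms by (auto simp: tsp_sequences_def darp_sequences_def comp_def sorted_append
      map_replicate_const)
qed

lemma filter_adversary:
  assumes "e > 0" "t < e * real (Suc k)" "k \<le> m"
  shows "filter (\<lambda>r. release r \<le> t) (adversary A leaf N e m) =
    filter (\<lambda>r. release r \<le> t) (adversary A leaf N e k)"
  using \<open>k \<le> m\<close>
proof (induction m rule: dec_induct)
  case (step m)
  have "e * real (Suc k) \<le> e * real (Suc m)" using step assms(1) by simp
  then have "\<not> e * real (Suc m) \<le> t" using assms(2) by linarith
  then show ?case using step by (simp add: filter_map comp_def)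
qed simp

text \<open>The next batch comes exactly at \<open>e * real (Suc k)\<close>: before that time the
  online property applies, at that time continuity does. The endpoint matters because windows are
  closed.\<close>

lemma online_adversary_agree:
  assumes "Metric_space M d" "online_algorithm M d orig S A" "tsp_sequences M \<subseteq> S"
    and "e > 0" "\<And>i. i < N \<Longrightarrow> leaf i \<in> M"
    and "0 \<le> t" "t \<le> e * real (Suc k)" "k \<le> m"
  shows "A (adversary A leaf N e m) t = A (adversary A leaf N e k) t"
proof -
  have inS: "adversary A leaf N e n \<in> S" for n
    using adversary_in_tsp_sequences[of e N leaf M A n] assms by blast
  have less: "A (adversary A leaf N e m) u = A (adversary A leaf N e k) u"
    if "0 \<le> u" "u < e * real (Suc k)" for u
    using assms(2) inS filter_adversary[OF \<open>e > 0\<close> that(2) \<open>k \<le> m\<close>, of A leaf N] that(1)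
    unfolding online_algorithm_def by blast
  moreover have "A (adversary A leaf N e m) (e * real (Suc k)) =
      A (adversary A leaf N e k) (e * real (Suc k))"
    by (rule server_paths_agree_at_limit[OF assms(1) _ _ _ less])
      (use assms(2,4) inS in \<open>auto simp: online_algorithm_def\<close>)
  ultimately show ?thesis using assms(6,7) by (cases "t = e * real (Suc k)") auto
qed

text \<open>All intermediate runs are replaced by one final run, so that the cost bounds concern a
  single fixed path.\<close>

lemma set_adversary:
  assumes "Metric_space M d" "online_algorithm M d orig S A" "tsp_sequences M \<subseteq> S"
    and "e > 0" "\<And>i. i < N \<Longrightarrow> leaf i \<in> M" and "k \<le> m"
  shows "set (adversary A leaf N e k) = {Request 0 (leaf i) (leaf i) |i. i < N} \<union>
    {Request (e * real (Suc j)) (leaf i) (leaf i) |i j.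
      i < N \<and> j < k \<and> visited_during (A (adversary A leaf N e m)) e (leaf i) j}"
  using \<open>k \<le> m\<close>
proof (induction k)
  case 0
  then show ?case by auto
next
  case (Suc k)
  have "visited_during (A (adversary A leaf N e k)) e x k =
      visited_during (A (adversary A leaf N e m)) e x k" for x
  proof -
    have "A (adversary A leaf N e m) s = A (adversary A leaf N e k) s"
      if "e * real k \<le> s" "s \<le> e * real (Suc k)" for s
    proof (rule online_adversary_agree[OF assms(1-5)])
      show "0 \<le> s" using that(1) \<open>e > 0\<close> by (meson less_imp_le mult_nonneg_nonneg of_nat_0_le_iff order_trans)
    qed (use that Suc.prems in auto)
    then show ?thesis unfolding visited_during_def by metis
  qed
  then show ?case using Suc by (auto simp: less_Suc_eq)
qed

text \<open>A repeated leaf was visited at most \<open>e\<close> time units before its release, and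
  the server has moved at most \<open>e\<close> since; the initial requests are issued while the
  server is at the origin.\<close>

lemma spatially_local_adversary:
  assumes "Metric_space M d" "online_algorithm M d orig S A" "tsp_sequences M \<subseteq> S"
    and "e > 0" "e \<le> \<Delta>" "\<And>i. i < N \<Longrightarrow> leaf i \<in> M" "\<And>i. i < N \<Longrightarrow> d orig (leaf i) \<le> \<Delta>"
  shows "spatially_local d \<Delta> (A (adversary A leaf N e m)) (adversary A leaf N e m)"
  unfolding spatially_local_def
proof
  let ?p = "A (adversary A leaf N e m)"
  have path: "server_path M d orig ?p"
    using assms(2,3) adversary_in_tsp_sequences[of e N leaf M A m] assms(4,6)
    by (auto simp: online_algorithm_def)
  fix r assume "r \<in> set (adversary A leaf N e m)"
  then consider i where "i < N" "r = Request 0 (leaf i) (leaf i)"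
    | i j where "i < N" "r = Request (e * real (Suc j)) (leaf i) (leaf i)"
        "visited_during ?p e (leaf i) j"
    using set_adversary[of M d orig S A e N leaf m m] assms by auto
  then show "d (?p (release r)) (source r) \<le> \<Delta>"
  proof cases
    case 1
    then show ?thesis using path assms(7) by (simp add: server_path_def)
  next
    case 2
    then obtain s where s: "e * real j \<le> s" "s \<le> e * real (Suc j)" "?p s = leaf i"
      by (auto simp: visited_during_def)
    have "0 \<le> e * real j" using \<open>e > 0\<close> by simp
    then have "0 \<le> s" "0 \<le> e * real (Suc j)" using s by linarith+
    then have "d (?p (e * real (Suc j))) (?p s) \<le> \<bar>e * real (Suc j) - s\<bar>"
      using path unfolding server_path_def by blast
    also have "\<dots> \<le> e" using s by (simp add: algebra_simps)
    finally show ?thesis using 2 s \<open>e \<le> \<Delta>\<close> by simp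
  qed
qed

section \<open>The lower bound\<close>

lemma visited_duringI:
  assumes "e > 0" "e * real k \<le> t" "t \<le> e * real K" "k < K" "p t = x"
  obtains j where "k \<le> j" "j < K" "visited_during p e x j"
proof (cases "t = e * real K")
  \<comment> \<open>Here the floor of \<open>t / e\<close> would be \<open>K\<close>, which is out
    of range, but the closed window \<open>K - 1\<close> still contains \<open>t\<close>.\<close>
  case True
  then have "visited_during p e x (K - 1)"
    using assms by (auto simp: visited_during_def intro!: exI[of _ t])
  then show ?thesis using that[of "K - 1"] assms by auto
next
  case False
  define j where "j = nat \<lfloor>t / e\<rfloor>"
  have "real k \<le> t / e" "t / e < real K"
    using assms False by (auto simp: field_simps)
  then have "k \<le> j" "j < K" "real j \<le> t / e" "t / e \<le> real (Suc j)"
    unfolding j_def by linarith+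
  then have "e * real j \<le> t" "t \<le> e * real (Suc j)"
    using \<open>e > 0\<close> by (simp_all add: field_simps)
  then have "visited_during p e x j" using assms by (auto simp: visited_during_def)
  with that \<open>k \<le> j\<close> \<open>j < K\<close> show ?thesis by blast
qed

text \<open>The requests enter only through their dependence on the fixed path \<open>p\<close>. The
  two bounds have ratio \<open>(2 * N - 2) / (N + 2)\<close>, which tends to 2.\<close>

lemma adversary_gap:
  fixes p :: "real \<Rightarrow> nat \<times> real"
  assumes path: "server_path (star l) star_dist (0, 0) p"
    and e: "e > 0" "e \<le> l" and N: "N \<ge> 2"
    and \<sigma>: "set \<sigma> = {Request 0 (on_ray i e) (on_ray i e) |i. i < N} \<union>
      {Request (e * real (Suc j)) (on_ray i e) (on_ray i e) |i j.
        i < N \<and> j < 2 * N \<and> visited_during p e (on_ray i e) j}"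
  shows "ennreal (2 * e * real (2 * N - 2)) \<le> last_completion p \<sigma>"
    and "OPT v (star l) star_dist (0, 0) \<sigma> \<le> ennreal (2 * e * real (N + 2))"
proof -
  have sep: "2 * e \<le> \<bar>s - t\<bar>"
    if "p s = on_ray i e" "p t = on_ray j e" "i \<noteq> j" "0 \<le> s" "0 \<le> t" for s t i j
  proof -
    have "star_dist (p s) (p t) \<le> \<bar>s - t\<bar>" using path that(4,5) unfolding server_path_def by blast
    then show ?thesis using that e by (simp add: star_dist_on_ray)
  qed
  \<comment> \<open>If \<open>V i\<close> is nonempty, the last request of leaf \<open>i\<close> is
    released at \<open>e * real (Suc (Max (V i)))\<close>; otherwise its only release time is
    0.\<close>
  define V where "V i = {k. k < 2 * N \<and> visited_during p e (on_ray i e) k}" for i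
  have finV: "finite (V i)" for i by (simp add: V_def)

  show "ennreal (2 * e * real (2 * N - 2)) \<le> last_completion p \<sigma>"
  proof (rule ccontr)
    assume "\<not> ?thesis"
    then have small: "last_completion p \<sigma> < ennreal (2 * e * real (2 * N - 2))" by simp
    \<comment> \<open>Leaves visited in the last window are set aside: their final request comes at
      \<open>e * real (2 * N)\<close> and may be served at that instant. Two of them would be
      visited within \<open>e\<close> of each other, but leaves are \<open>2 * e\<close>
      apart.\<close>
    define B where "B = {i. i < N \<and> 2 * N - 1 \<in> V i}"
    have "card B \<le> 1"
    proof (rule card_le_Suc0_iff_eq[THEN iffD2, folded One_nat_def])
      show "\<forall>i\<in>B. \<forall>j\<in>B. i = j"
      proof (intro ballI, rule ccontr)
        fix i j assume "i \<in> B" "j \<in> B" "i \<noteq> j"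
        then obtain s t where st: "p s = on_ray i e" "p t = on_ray j e"
          "e * real (2 * N - 1) \<le> s" "e * real (2 * N - 1) \<le> t"
          "s \<le> e * real (Suc (2 * N - 1))" "t \<le> e * real (Suc (2 * N - 1))"
          by (auto simp: B_def V_def visited_during_def)
        have "0 \<le> e * real (2 * N - 1)" using e by simp
        then have "0 \<le> s" "0 \<le> t" using st by linarith+
        moreover have "\<bar>s - t\<bar> \<le> e"
          using st(3-6) unfolding of_nat_Suc distrib_left by linarith
        ultimately show False using sep[OF st(1,2) \<open>i \<noteq> j\<close>] e by linarith
      qed
    qed (simp add: B_def)
    have "\<exists>t. e * real (2 * N) \<le> t \<and> t < 2 * e * real (2 * N - 2) \<and> p t = on_ray i e"
      if i: "i \<in> {..<N} - B" for i
    proof -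
      \<comment> \<open>\<open>k\<close> indexes the release of the last request of leaf
        \<open>i\<close>. No window from \<open>k\<close> on contains a visit, so this request is
        still open at \<open>e * real (2 * N)\<close>.\<close>
      obtain k where k: "k < 2 * N" "Request (e * real k) (on_ray i e) (on_ray i e) \<in> set \<sigma>"
        "\<And>j. j \<in> V i \<Longrightarrow> j < k"
      proof (cases "V i = {}")
        case True
        then show ?thesis using that[of 0] i N by (auto simp: \<sigma>)
      next
        case False
        then have max: "Max (V i) \<in> V i" using finV by simp
        then have "Suc (Max (V i)) < 2 * N"
          using i by (cases "Max (V i) = 2 * N - 1") (auto simp: V_def B_def)
        moreover have "Request (e * real (Suc (Max (V i)))) (on_ray i e) (on_ray i e) \<in> set \<sigma>"
          using max i unfolding \<sigma> V_def by blast
        moreover have "j < Suc (Max (V i))" if "j \<in> V i" for j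
          using Max_ge[OF finV that] by simp
        ultimately show ?thesis using that by blast
      qed
      have "completion_time p (Request (e * real k) (on_ray i e) (on_ray i e)) \<le> last_completion p \<sigma>"
        unfolding last_completion_def by (rule SUP_upper) (rule k)
      then have "completion_time p (Request (e * real k) (on_ray i e) (on_ray i e)) <
          ennreal (2 * e * real (2 * N - 2))"
        using small by (rule le_less_trans)
      then obtain t where t: "e * real k \<le> t" "p t = on_ray i e"
        "ennreal t < ennreal (2 * e * real (2 * N - 2))"
        unfolding completion_time_def INF_less_iff by (auto intro: order_trans)
      moreover have "e * real (2 * N) \<le> t"
      proof (rule ccontr)
        assume "\<not> ?thesis"
        then have "t \<le> e * real (2 * N)" by simp
        then obtain j where "k \<le> j" "j < 2 * N" "visited_during p e (on_ray i e) j"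
          by (rule visited_duringI[where p = p, OF e(1) t(1) _ k(1) t(2)])
        then show False using k(3)[of j] by (simp add: V_def)
      qed
      moreover have "t < 2 * e * real (2 * N - 2)"
      proof (rule ccontr)
        assume "\<not> ?thesis"
        then have "ennreal (2 * e * real (2 * N - 2)) \<le> ennreal t"
          by (intro ennreal_leI) (simp only: not_less)
        from leD[OF this] t(3) show False by (rule notE)
      qed
      ultimately show ?thesis by blast
    qed
    then obtain t where t: "\<And>i. i \<in> {..<N} - B \<Longrightarrow>
        e * real (2 * N) \<le> t i \<and> t i < 2 * e * real (2 * N - 2) \<and> p (t i) = on_ray i e"
      by metis
    have pos: "0 \<le> e * real (2 * N)" using e by simp
    \<comment> \<open>Only \<open>N - 2\<close> separated visits fit into the remaining time,
      whereas at least \<open>N - 1\<close> leaves still need one.\<close>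
    have "card ({..<N} - B) \<le> N - 2"
    proof (rule card_separated_le)
      show "0 < 2 * e" using e by simp
      show "2 * e \<le> \<bar>t i - t j\<bar>" if "i \<in> {..<N} - B" "j \<in> {..<N} - B" "i \<noteq> j" for i j
        using sep[of "t i" i "t j" j] t[OF that(1)] t[OF that(2)] that(3) pos by linarith
      show "e * real (2 * N) \<le> t i \<and> t i < e * real (2 * N) + 2 * e * real (N - 2)"
        if "i \<in> {..<N} - B" for i
        using t[OF that] N by (simp add: of_nat_diff algebra_simps)
    qed
    moreover have "card ({..<N} - B) = N - card B"
      by (subst card_Diff_subset) (auto simp: B_def)
    ultimately show False using \<open>card B \<le> 1\<close> N by linarith
  qed

  define P where "P = {i. i < N \<and> V i \<noteq> {}}"
  \<comment> \<open>The offline bound may use any visit in the last visited window; it need not be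
    the latest one.\<close>
  have "\<exists>s. e * real (Max (V i)) \<le> s \<and> s \<le> e * real (Suc (Max (V i))) \<and> p s = on_ray i e"
    if "i \<in> P" for i
    using Max_in[OF finV, of i] that by (auto simp: P_def V_def visited_during_def)
  then obtain s where s: "\<And>i. i \<in> P \<Longrightarrow> e * real (Max (V i)) \<le> s i \<and>
      s i \<le> e * real (Suc (Max (V i))) \<and> p (s i) = on_ray i e"
    by metis
  have s_nonneg: "0 \<le> s i" if "i \<in> P" for i
  proof -
    have "0 \<le> e * real (Max (V i))" using e by simp
    then show ?thesis using s[OF that] by linarith
  qed
  \<comment> \<open>The slot after the one containing \<open>s i\<close> starts after
    \<open>s i\<close>, and its leaf is reached \<open>e\<close> later, hence not before the last
    request of leaf \<open>i\<close>.\<close>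
  define f where "f i = nat \<lfloor>s i / (2 * e)\<rfloor> + 1" for i
  have "inj_on (\<lambda>i. \<lfloor>s i / (2 * e)\<rfloor>) P"
    using s s_nonneg e sep by (intro inj_on_floor_separated) auto
  moreover have "0 \<le> \<lfloor>s i / (2 * e)\<rfloor>" if "i \<in> P" for i
    using s_nonneg[OF that] e by simp
  ultimately have inj_f: "inj_on f P" by (auto simp: inj_on_def f_def nat_eq_iff)
  \<comment> \<open>A visit exactly at \<open>2 * e * real N\<close> is assigned slot
    \<open>N + 1\<close>, which is why \<open>N + 2\<close> slots are provided.\<close>
  have f_slots: "f ` P \<subseteq> {..<N + 2}"
  proof (rule image_subsetI)
    fix i assume "i \<in> P"
    then have "Max (V i) \<in> V i" using finV by (intro Max_in) (auto simp: P_def)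
    then have "e * real (Suc (Max (V i))) \<le> e * real (2 * N)"
      using e by (intro mult_left_mono) (auto simp: V_def)
    then have "s i \<le> 2 * e * real N" using s[OF \<open>i \<in> P\<close>] by simp
    then have "s i / (2 * e) \<le> real N" using e by (simp add: field_simps)
    then show "f i \<in> {..<N + 2}" unfolding f_def lessThan_iff by linarith
  qed
  \<comment> \<open>Leaves outside \<open>P\<close> are requested only at time 0, so any free slot
    serves them.\<close>
  obtain g where g: "inj_on g {..<N}" "g ` {..<N} \<subseteq> {..<N + 2}"
      "\<And>i. i \<in> P \<Longrightarrow> g i = f i"
    by (rule inj_on_extend[OF inj_f f_slots, of "{..<N}"]) (auto simp: P_def)
  \<comment> \<open>Slots outside the image of \<open>g\<close> get an arbitrary ray from
    \<open>inv_into\<close>; such an excursion is harmless.\<close>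
  define q where "q = tour (2 * e) (inv_into {..<N} g)"
  have q_path: "server_path (star l) star_dist (0, 0) q"
    unfolding q_def using e by (intro server_path_tour) auto
  have q_leaf: "q (2 * e * real (g i) + e) = on_ray i e" if "i < N" for i
    using tour_at_half[of "2 * e" "inv_into {..<N} g" "g i"] e that g(1) by (simp add: q_def)
  have q_late: "e * real (Suc j) \<le> 2 * e * real (g i) + e" if "i < N" "j \<in> V i" for i j
  proof -
    have "i \<in> P" using that by (auto simp: P_def)
    have "s i / (2 * e) \<le> real (g i)"
      unfolding g(3)[OF \<open>i \<in> P\<close>] f_def by linarith
    then have "s i \<le> 2 * e * real (g i)" using e by (simp add: field_simps)
    moreover have "e * real j \<le> e * real (Max (V i))"
      using e Max_ge[OF finV that(2)] by (intro mult_left_mono) auto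
    ultimately show ?thesis using s[OF \<open>i \<in> P\<close>] by (simp add: algebra_simps)
  qed
  have "last_completion q \<sigma> \<le> ennreal (2 * e * real (N + 2))"
    unfolding last_completion_def
  proof (rule SUP_least)
    fix r assume "r \<in> set \<sigma>"
    then obtain i where i: "i < N" "source r = on_ray i e" "destination r = on_ray i e"
      "release r \<le> 2 * e * real (g i) + e"
      using q_late e unfolding \<sigma> V_def by (auto simp del: of_nat_Suc)
    have "completion_time q r \<le> ennreal (2 * e * real (g i) + e)"
      using i q_leaf by (intro completion_time_le) auto
    also have "real (g i) + 1 \<le> real (N + 2)" using g(2) i(1) by fastforce
    then have "2 * e * (real (g i) + 1) \<le> 2 * e * real (N + 2)"
      using e by (intro mult_left_mono) auto
    then have "ennreal (2 * e * real (g i) + e) \<le> ennreal (2 * e * real (N + 2))"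
      using e by (intro ennreal_leI) (simp add: algebra_simps)
    finally show "completion_time q r \<le> ennreal (2 * e * real (N + 2))" .
  qed
  \<comment> \<open>The last slot ends at the centre, so returning home costs nothing beyond the
    \<open>N + 2\<close> slots.\<close>
  moreover have "q (2 * e * real (N + 2)) = (0, 0)"
    unfolding q_def using e by (intro tour_at_multiple) simp
  ultimately have "cost v (0, 0) q \<sigma> \<le> ennreal (2 * e * real (N + 2))"
    using e by (intro cost_le) auto
  then show "OPT v (star l) star_dist (0, 0) \<sigma> \<le> ennreal (2 * e * real (N + 2))"
    unfolding OPT_def using q_path by (intro INF_lower2) auto
qed

text \<open>The adversary issues TSP requests only, so a general class \<open>S\<close> containing
  them covers TSP and dial-a-ride together.\<close>

lemma not_competitive_star:
  assumes "\<Delta> > 0" "l > 0" "c < 2"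
    and S: "tsp_sequences (star l) \<subseteq> S"
    and A: "online_algorithm (star l) star_dist (0, 0) S A"
  shows "\<not> competitive v (star l) star_dist (0, 0) \<Delta> S c A"
proof
  assume comp: "competitive v (star l) star_dist (0, 0) \<Delta> S c A"
  define e where "e = min \<Delta> l"
  \<comment> \<open>\<open>ennreal\<close> sends negative numbers to 0, so this leaves the factor
    unchanged while allowing real arithmetic.\<close>
  define c' where "c' = max c 0"
  have e: "e > 0" "e \<le> \<Delta>" "e \<le> l" using assms by (auto simp: e_def)
  have c': "0 \<le> c'" "c' < 2" using \<open>c < 2\<close> by (auto simp: c'_def)
  \<comment> \<open>The threshold is \<open>c' * (N + 2) < 2 * N - 2\<close> solved for
    \<open>N\<close>.\<close>
  obtain n :: nat where n: "(2 * c' + 2) / (2 - c') < real n" using reals_Archimedean2 by blast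
  define N where "N = max 2 n"
  have "(2 * c' + 2) / (2 - c') < real N" using n by (simp add: N_def)
  then have N: "c' * real (N + 2) < real (2 * N - 2)" "N \<ge> 2"
    using c' by (auto simp: N_def field_simps of_nat_diff)
  define leaf where "leaf i = on_ray i e" for i
  define \<sigma> where "\<sigma> = adversary A leaf N e (2 * N)"
  have leaf: "leaf i \<in> star l" "star_dist (0, 0) (leaf i) \<le> \<Delta>" for i
    using e on_ray_in_star[of e l i] by (auto simp: leaf_def star_dist_def on_ray_def)
  have tsp: "\<sigma> \<in> S"
    using adversary_in_tsp_sequences[of e N leaf "star l" A "2 * N"] e leaf S by (auto simp: \<sigma>_def)
  have path: "server_path (star l) star_dist (0, 0) (A \<sigma>)"
    using A tsp by (auto simp: online_algorithm_def)
  have "set \<sigma> = {Request 0 (on_ray i e) (on_ray i e) |i. i < N} \<union>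
      {Request (e * real (Suc j)) (on_ray i e) (on_ray i e) |i j.
        i < N \<and> j < 2 * N \<and> visited_during (A \<sigma>) e (on_ray i e) j}"
    using set_adversary[OF Metric_space_star A S e(1), of N leaf "2 * N" "2 * N"] leaf
    unfolding \<sigma>_def leaf_def by simp
  note gap = adversary_gap[OF path e(1,3) N(2) this]
  have "spatially_local star_dist \<Delta> (A \<sigma>) \<sigma>"
    unfolding \<sigma>_def by (rule spatially_local_adversary[OF Metric_space_star A S e(1,2) leaf])
  then have "cost v (0, 0) (A \<sigma>) \<sigma> \<le> ennreal c * OPT v (star l) star_dist (0, 0) \<sigma>"
    using comp tsp by (auto simp: competitive_def)
  also have "\<dots> \<le> ennreal c' * ennreal (2 * e * real (N + 2))"
    by (rule mult_mono[OF _ gap(2)]) (auto simp: c'_def ennreal_leI)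
  also have "\<dots> = ennreal (2 * e * (c' * real (N + 2)))"
    using c' e by (simp add: ennreal_mult[symmetric] mult_ac)
  also have "\<dots> < ennreal (2 * e * real (2 * N - 2))"
    using N e c' by (intro ennreal_lessI mult_strict_left_mono) auto
  also have "\<dots> \<le> cost v (0, 0) (A \<sigma>) \<sigma>"
    using gap(1) last_completion_le_cost by (rule order_trans)
  finally show False by simp
qed

theorem theorem2:
  fixes \<Delta> D :: real
  assumes "\<Delta> > 0" and "D > 0"
  shows "\<exists>(M :: (nat \<times> real) set) d orig.
    server_space M d orig D \<and>
    (\<forall>v c. c < 2 \<longrightarrow>
       (\<nexists>A. online_algorithm M d orig (tsp_sequences M) A \<and>
            competitive v M d orig \<Delta> (tsp_sequences M) c A) \<and>
       (\<nexists>A. online_algorithm M d orig (darp_sequences M) A \<and>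
            competitive v M d orig \<Delta> (darp_sequences M) c A))"
proof -
  have "tsp_sequences M \<subseteq> darp_sequences M" for M :: "(nat \<times> real) set"
    by (auto simp: tsp_sequences_def)
  then show ?thesis
    using server_space_star[OF \<open>D > 0\<close>] not_competitive_star[OF \<open>\<Delta> > 0\<close>, of "D/2"] \<open>D > 0\<close>
    by (intro exI[of _ "star (D/2)"] exI[of _ star_dist] exI[of _ "(0, 0)"]) auto
qed

end
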